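(* Let $A$ be a pointed monoid. Then $A$ is a domain if, and only if, $A$ is integral and satisfies $\#\{x\in A \mid x^n=\alpha\}\le n$ for every $\alpha$ in $A$ and $n\ge1$.
   Context: A pointed monoid is a set $A$ with an associative and commutative multiplication, an element $1$ with $1\cdot a=a$ for all $a\in A$, and an absorbing element $0$ with $0\cdot a=0$ for all $a\in A$. A pointed monoid $A$ is integral if, for all $a,b,c\in A$, $ab=ac$ implies $a=0$ or $b=c$. For a field $K$, $K^\bullet$ denotes the pointed monoid obtained from $K$ by forgetting addition. A domain is a pointed monoid that is isomorphic to a pointed submonoid (a multiplicatively closed subset containing $0$ and $1$) of $K^\bullet$ for some field $K$.
   Formalization: The formal theorem assumes 1 ≠ 0 in A; the one-element pointed monoid A = {0} is integral and satisfies the root bound but is not a domain, since 0 ≠ 1 in every field, so the claim fails for exactly that A. *)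

theory Defs
  imports "HOL-Algebra.Algebra"
begin

section \<open>Pointed monoids\<close>

record 'a pointed_monoid = "'a monoid" +
  absorb :: 'a

text \<open>The equation \<open>absorb A = \<one>\<^bsub>A\<^esub>\<close> is not excluded: a one-element structure is a pointed monoid.\<close>

locale pointed_monoid = comm_monoid A for A (structure) +
  assumes absorb_closed: "absorb A \<in> carrier A"
    and absorb_mult: "a \<in> carrier A \<Longrightarrow> absorb A \<otimes> a = absorb A"

definition pm_integral :: "('a, 'b) pointed_monoid_scheme \<Rightarrow> bool" where
  "pm_integral A \<longleftrightarrow>
    (\<forall>a\<in>carrier A. \<forall>b\<in>carrier A. \<forall>c\<in>carrier A.
       a \<otimes>\<^bsub>A\<^esub> b = a \<otimes>\<^bsub>A\<^esub> c \<longrightarrow> a = absorb A \<or> b = c)"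

definition pointed_submonoid :: "'a set \<Rightarrow> ('a, 'b) pointed_monoid_scheme \<Rightarrow> bool" where
  "pointed_submonoid S A \<longleftrightarrow> submonoid S A \<and> absorb A \<in> S"

definition pm_isomorphic ::
    "('a, 'b) pointed_monoid_scheme \<Rightarrow> ('c, 'd) pointed_monoid_scheme \<Rightarrow> bool" where
  "pm_isomorphic A B \<longleftrightarrow>
    (\<exists>f. f \<in> iso A B \<and> f \<one>\<^bsub>A\<^esub> = \<one>\<^bsub>B\<^esub> \<and> f (absorb A) = absorb B)"


section \<open>Domains\<close>

definition forget_add :: "('k, 'm) ring_scheme \<Rightarrow> 'k pointed_monoid" where
  "forget_add K = \<lparr>carrier = carrier K, monoid.mult = (\<otimes>\<^bsub>K\<^esub>), one = \<one>\<^bsub>K\<^esub>, absorb = \<zero>\<^bsub>K\<^esub>\<rparr>"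

definition embeds_in_field ::
    "('a, 'b) pointed_monoid_scheme \<Rightarrow> ('k, 'm) ring_scheme \<Rightarrow> bool" where
  "embeds_in_field A K \<longleftrightarrow>
    (\<exists>S. pointed_submonoid S (forget_add K) \<and>
         pm_isomorphic A ((forget_add K)\<lparr>carrier := S\<rparr>))"

text \<open>A quantifier inside a formula cannot range over fields of all types.  The type
  \<^typ>\<open>('a + nat) list\<close> has the cardinality of \<^typ>\<open>'a\<close>, or is countably infinite if \<^typ>\<open>'a\<close> is
  finite, which leaves room for the subfield generated by the image of \<open>A\<close> in any field.  So this
  choice of type is no restriction: a field of any type will do, as \<open>pm_domainI\<close> below shows.\<close>

definition pm_domain :: "('a, 'b) pointed_monoid_scheme \<Rightarrow> bool" where
  "pm_domain A \<longleftrightarrow> (\<exists>K :: ('a + nat) list ring. field K \<and> embeds_in_field A K)"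

text \<open>Elements of the generated subfield are named by words in reverse Polish notation.\<close>

definition rpn_step :: "('k, 'm) ring_scheme \<Rightarrow> ('a \<Rightarrow> 'k) \<Rightarrow> 'a + nat \<Rightarrow> 'k list \<Rightarrow> 'k list" where
  "rpn_step K f s st = (case s of
      Inl a \<Rightarrow> f a # st
    | Inr n \<Rightarrow>
       (if n = 0 then \<one>\<^bsub>K\<^esub> # st
        else if n = 2 then (\<ominus>\<^bsub>K\<^esub> (hd st)) # tl st
        else if n = 3 then (inv\<^bsub>K\<^esub> (hd st)) # tl st
        else if n = 4 then (hd (tl st) \<oplus>\<^bsub>K\<^esub> hd st) # tl (tl st)
        else (hd (tl st) \<otimes>\<^bsub>K\<^esub> hd st) # tl (tl st)))"

lemma rpn_step_simps:
  "rpn_step K f (Inl a) st = f a # st"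
  "rpn_step K f (Inr 0) st = \<one>\<^bsub>K\<^esub> # st"
  "rpn_step K f (Inr 2) (x # st) = (\<ominus>\<^bsub>K\<^esub> x) # st"
  "rpn_step K f (Inr 3) (x # st) = (inv\<^bsub>K\<^esub> x) # st"
  "rpn_step K f (Inr 4) (y # x # st) = (x \<oplus>\<^bsub>K\<^esub> y) # st"
  "rpn_step K f (Inr 5) (y # x # st) = (x \<otimes>\<^bsub>K\<^esub> y) # st"
  by (simp_all add: rpn_step_def)

lemma rpn_word_exists:
  assumes "h \<in> generate_field K (f ` C)"
  shows "\<exists>w. \<forall>st. fold (rpn_step K f) w st = h # st"
  using assms
proof (induction rule: generate_field.induct)
  case one
  show ?case by (rule exI[of _ "[Inr 0]"]) (simp add: rpn_step_simps)
next
  case (incl h)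
  then obtain a where "h = f a" by blast
  then show ?case by (intro exI[of _ "[Inl a]"]) (simp add: rpn_step_simps)
next
  case (a_inv h)
  then obtain w where "\<forall>st. fold (rpn_step K f) w st = h # st" by blast
  then show ?case by (intro exI[of _ "w @ [Inr 2]"]) (simp add: rpn_step_simps)
next
  case (m_inv h)
  then obtain w where "\<forall>st. fold (rpn_step K f) w st = h # st" by blast
  then show ?case by (intro exI[of _ "w @ [Inr 3]"]) (simp add: rpn_step_simps)
next
  case (eng_add h1 h2)
  then obtain v w where "\<forall>st. fold (rpn_step K f) v st = h1 # st"
    "\<forall>st. fold (rpn_step K f) w st = h2 # st" by blast
  then show ?case by (intro exI[of _ "v @ w @ [Inr 4]"]) (simp add: rpn_step_simps)
next
  case (eng_mult h1 h2)
  then obtain v w where "\<forall>st. fold (rpn_step K f) v st = h1 # st"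
    "\<forall>st. fold (rpn_step K f) w st = h2 # st" by blast
  then show ?case by (intro exI[of _ "v @ w @ [Inr 5]"]) (simp add: rpn_step_simps)
qed

lemma pm_domainI:
  fixes A :: "('a, 'b) pointed_monoid_scheme" and K :: "('k, 'm) ring_scheme"
  assumes A: "pointed_monoid A" and K: "field K" and emb: "embeds_in_field A K"
  shows "pm_domain A"
proof -
  interpret A: pointed_monoid A by (rule A)
  interpret K: field K by (rule K)
  obtain S f where S: "pointed_submonoid S (forget_add K)"
    and f: "f \<in> iso A ((forget_add K)\<lparr>carrier := S\<rparr>)"
    and f1: "f \<one>\<^bsub>A\<^esub> = \<one>\<^bsub>K\<^esub>" and f0: "f (absorb A) = \<zero>\<^bsub>K\<^esub>"
    using emb by (auto simp: embeds_in_field_def pm_isomorphic_def forget_add_def)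
  have S_sub: "S \<subseteq> carrier K"
    using S submonoid.subset by (fastforce simp: pointed_submonoid_def forget_add_def)
  have bij: "bij_betw f (carrier A) S"
    and hom: "\<And>x y. x \<in> carrier A \<Longrightarrow> y \<in> carrier A \<Longrightarrow> f (x \<otimes>\<^bsub>A\<^esub> y) = f x \<otimes>\<^bsub>K\<^esub> f y"
    using f by (auto simp: iso_def hom_def forget_add_def)
  have img: "f ` carrier A = S" using bij by (simp add: bij_betw_def)
  define L where "L = generate_field K (f ` carrier A)"
  define K1 where "K1 = K\<lparr>carrier := L\<rparr>"
  have "field K1"
    unfolding K1_def L_def by (rule K.generate_field_is_field) (use img S_sub in simp)
  then interpret K1: field K1 .
  have SL: "S \<subseteq> L" using img by (auto simp: L_def intro: generate_field.incl)
  define g where "g h = (SOME w. \<forall>st. fold (rpn_step K f) w st = h # st)" for h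
  have g: "fold (rpn_step K f) (g h) [] = [h]" if "h \<in> L" for h
    using someI_ex[OF rpn_word_exists[of h K f "carrier A"]] that
    by (simp add: g_def L_def)
  have inj: "inj_on g L"
    by (rule inj_onI) (metis g list.inject)
  then have inj1: "inj_on g (carrier K1)" by (simp add: K1_def)
  define M where "M = image_ring g K1"
  have M: "field M" unfolding M_def by (rule K1.inj_imp_image_ring_is_field[OF inj1])
  have "g \<in> ring_iso K1 M" unfolding M_def by (rule inj_imp_image_ring_iso[OF inj1])
  then have gmult: "\<And>x y. x \<in> L \<Longrightarrow> y \<in> L \<Longrightarrow> g (x \<otimes>\<^bsub>K\<^esub> y) = g x \<otimes>\<^bsub>M\<^esub> g y"
    by (auto simp: ring_iso_def ring_hom_def K1_def)
  have g1: "\<one>\<^bsub>M\<^esub> = g \<one>\<^bsub>K\<^esub>" and g0: "\<zero>\<^bsub>M\<^esub> = g \<zero>\<^bsub>K\<^esub>"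
    by (simp_all add: M_def image_ring_one image_ring_zero K1_def)
  have gL: "carrier M = g ` L" by (simp add: M_def image_ring_carrier K1_def)
  have S1: "\<one>\<^bsub>K\<^esub> \<in> S" "\<zero>\<^bsub>K\<^esub> \<in> S" "\<And>x y. x \<in> S \<Longrightarrow> y \<in> S \<Longrightarrow> x \<otimes>\<^bsub>K\<^esub> y \<in> S"
    using S by (auto simp: pointed_submonoid_def forget_add_def submonoid_def)
  have gS: "g x \<otimes>\<^bsub>M\<^esub> g y \<in> g ` S" if "x \<in> S" "y \<in> S" for x y
    using that S1(3)[of x y] gmult[of x y] SL by (metis imageI subsetD)
  have "pointed_submonoid (g ` S) (forget_add M)"
    unfolding pointed_submonoid_def submonoid_def forget_add_def
    using S1 SL gL g1 g0 by (auto intro: gS)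
  moreover have "pm_isomorphic A ((forget_add M)\<lparr>carrier := g ` S\<rparr>)"
    unfolding pm_isomorphic_def
  proof (intro exI[of _ "g \<circ> f"] conjI)
    have "bij_betw (g \<circ> f) (carrier A) (g ` S)"
      using bij inj SL by (meson bij_betw_trans bij_betw_imageI inj_on_subset)
    then show "g \<circ> f \<in> iso A ((forget_add M)\<lparr>carrier := g ` S\<rparr>)"
      using img SL by (auto simp: iso_def hom_def forget_add_def hom intro!: gmult)
  qed (simp_all add: f1 f0 g1 g0 forget_add_def)
  ultimately show ?thesis
    unfolding pm_domain_def embeds_in_field_def using M by blast
qed

text \<open>The pointed monoid with \<open>0 = 1\<close> is integral and has at most one root of each element, but it
  is not a domain, since a pointed submonoid of a field has at least two elements.\<close>

lemma one_eq_absorb_not_domain: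
  assumes "pointed_monoid A" and eq: "\<one>\<^bsub>A\<^esub> = absorb A"
  shows "pm_integral A" and "\<not> pm_domain A"
    and "\<And>n \<alpha>. n \<ge> 1 \<Longrightarrow> finite {x \<in> carrier A. x [^]\<^bsub>A\<^esub> (n::nat) = \<alpha>} \<and>
      card {x \<in> carrier A. x [^]\<^bsub>A\<^esub> n = \<alpha>} \<le> n"
proof -
  interpret A: pointed_monoid A by (rule assms(1))
  have triv: "x = absorb A" if "x \<in> carrier A" for x
    using A.l_one[OF that] A.absorb_mult[OF that] eq by simp
  then show "pm_integral A" by (auto simp: pm_integral_def)
  show "\<not> pm_domain A"
  proof
    assume "pm_domain A"
    then obtain K :: "('a + nat) list ring" where "field K" and "\<one>\<^bsub>K\<^esub> = \<zero>\<^bsub>K\<^esub>"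
      using eq by (auto simp: pm_domain_def embeds_in_field_def pm_isomorphic_def forget_add_def)
    then show False
      using field.is_ring domain.one_not_zero field.axioms(1) by blast
  qed
  fix n :: nat and \<alpha>
  assume n: "n \<ge> 1"
  have sub: "{x \<in> carrier A. x [^]\<^bsub>A\<^esub> n = \<alpha>} \<subseteq> {absorb A}" using triv by auto
  show "finite {x \<in> carrier A. x [^]\<^bsub>A\<^esub> n = \<alpha>} \<and> card {x \<in> carrier A. x [^]\<^bsub>A\<^esub> n = \<alpha>} \<le> n"
    using finite_subset[OF sub] card_mono[OF _ sub] n by auto
qed

end

theory Submission
  imports Defs "HOL-Analysis.Continuum_Not_Denumerable"
begin

text \<open>In a field, \<open>x\<^sup>n = \<alpha>\<close> is a polynomial equation, so it has at most \<open>n\<close> solutions.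

  Conversely, \<open>A - {0}\<close> is cancellative and has a group completion \<open>G\<close>.  Finitely many elements of
  \<open>G\<close> have a common denominator, so the bound on roots passes to \<open>G\<close>: each subgroup
  \<open>{g. g\<^sup>N = 1}\<close> is cyclic and has an injective complex character.  Adjoining finitely many
  elements one at a time, by an \<open>n\<close>-th root or by a number independent of the countably many values
  used so far, extends this character with torsion kernel.  If \<open>N\<close> kills all torsion quotients of
  elements of a finite set \<open>F\<close>, the extension is injective on \<open>F\<close>.  Hence \<open>A\<close> has, for each finite
  subset \<open>F\<close>, a complex-valued function that is injective and multiplicative on \<open>F\<close>, and these
  functions combine to an embedding of \<open>A\<close> into a quotient, by a maximal ideal, of the ring of complex
  functions on the finite subsets of \<open>A\<close>.\<close>

section \<open>Complex characters of abelian groups\<close>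

context comm_group
begin

text \<open>Values range over all nonzero complex numbers, not only over the unit circle; outside
  \<open>H\<close> the total function \<open>\<chi>\<close> is arbitrary.\<close>

definition complex_character :: "'a set \<Rightarrow> ('a \<Rightarrow> complex) \<Rightarrow> bool" where
  "complex_character H \<chi> \<longleftrightarrow>
     (\<forall>h\<in>H. \<chi> h \<noteq> 0) \<and> (\<forall>h\<in>H. \<forall>k\<in>H. \<chi> (h \<otimes> k) = \<chi> h * \<chi> k)"

lemma complex_characterD:
  assumes "complex_character H \<chi>"
  shows "h \<in> H \<Longrightarrow> \<chi> h \<noteq> 0"
    and "h \<in> H \<Longrightarrow> k \<in> H \<Longrightarrow> \<chi> (h \<otimes> k) = \<chi> h * \<chi> k"
  using assms by (auto simp: complex_character_def)

lemma complex_character_one: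
  assumes "complex_character H \<chi>" "subgroup H G"
  shows "\<chi> \<one> = 1"
proof -
  have "\<one> \<in> H" using assms(2) by (rule subgroup.one_closed)
  then have "\<chi> \<one> * \<chi> \<one> = \<chi> \<one>" "\<chi> \<one> \<noteq> 0"
    using complex_characterD[OF assms(1)] by (metis l_one one_closed)+
  then show ?thesis by simp
qed

lemma complex_character_inv:
  assumes "complex_character H \<chi>" "subgroup H G" "h \<in> H"
  shows "\<chi> (inv h) = inverse (\<chi> h)"
proof -
  have "inv h \<in> H" "h \<in> carrier G" using assms by (auto simp: subgroup.m_inv_closed subgroup.mem_carrier)
  then have "\<chi> (inv h) * \<chi> h = 1"
    using complex_characterD(2)[OF assms(1), of "inv h" h] assms(3) complex_character_one[OF assms(1,2)]
    by simp
  then show ?thesis by (metis inverse_unique mult.commute)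
qed

lemma complex_character_nat_pow:
  assumes "complex_character H \<chi>" "subgroup H G" "h \<in> H"
  shows "\<chi> (h [^] (n::nat)) = \<chi> h ^ n"
proof (induction n)
  case (Suc n)
  have "h [^] n \<in> H"
    using subgroup_int_pow_closed[OF assms(2,3), of "int n"] by (simp add: int_pow_int)
  with Suc show ?case
    using complex_characterD(2)[OF assms(1)] assms(3) by simp
qed (simp add: complex_character_one[OF assms(1,2)])

section \<open>Extending a character by one element\<close>

definition adjoin :: "'a set \<Rightarrow> 'a \<Rightarrow> 'a set" where
  "adjoin H x = (\<lambda>(h, k::int). h \<otimes> x [^] k) ` (H \<times> UNIV)"

lemma adjoinI: "h \<in> H \<Longrightarrow> h \<otimes> x [^] (k::int) \<in> adjoin H x"
  by (auto simp: adjoin_def)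

lemma adjoinE:
  assumes "u \<in> adjoin H x"
  obtains h and k :: int where "h \<in> H" "u = h \<otimes> x [^] k"
  using assms by (auto simp: adjoin_def)

lemma countable_adjoin: "countable H \<Longrightarrow> countable (adjoin H x)"
  by (simp add: adjoin_def)

lemma adjoin_mult:
  assumes "subgroup H G" "x \<in> carrier G" "h \<in> H" "h' \<in> H"
  shows "(h \<otimes> x [^] (k::int)) \<otimes> (h' \<otimes> x [^] k') = (h \<otimes> h') \<otimes> x [^] (k + k')"
proof -
  have "h \<in> carrier G" "h' \<in> carrier G" using assms by (auto simp: subgroup.mem_carrier)
  then show ?thesis using assms(2) by (simp add: int_pow_mult m_ac)
qed

lemma adjoin_inv:
  assumes "subgroup H G" "x \<in> carrier G" "h \<in> H"
  shows "inv (h \<otimes> x [^] (k::int)) = inv h \<otimes> x [^] (- k)"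
proof -
  have "h \<in> carrier G" using assms by (auto simp: subgroup.mem_carrier)
  then show ?thesis using assms(2) by (simp add: int_pow_neg inv_mult)
qed

lemma subgroup_adjoin:
  assumes H: "subgroup H G" and x: "x \<in> carrier G"
  shows "subgroup (adjoin H x) G"
proof (rule subgroupI)
  show "adjoin H x \<subseteq> carrier G"
    using x subgroup.mem_carrier[OF H] by (auto elim!: adjoinE)
  show "adjoin H x \<noteq> {}" using subgroup.one_closed[OF H] by (auto simp: adjoin_def)
next
  fix u assume "u \<in> adjoin H x"
  then show "inv u \<in> adjoin H x"
    by (elim adjoinE) (metis H x adjoin_inv adjoinI subgroup.m_inv_closed)
next
  fix u v assume "u \<in> adjoin H x" "v \<in> adjoin H x"
  then show "u \<otimes> v \<in> adjoin H x"
    by (elim adjoinE) (metis H x adjoin_mult adjoinI subgroup.m_closed)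
qed

lemma subset_adjoin:
  assumes H: "subgroup H G" and x: "x \<in> carrier G"
  shows "H \<subseteq> adjoin H x" "x \<in> adjoin H x"
proof -
  show "H \<subseteq> adjoin H x"
    by (metis adjoinI assms(1) int_pow_0 r_one subgroup.mem_carrier subsetI)
  show "x \<in> adjoin H x"
    using adjoinI[OF subgroup.one_closed[OF H], of x 1] x by simp
qed

text \<open>Two representations of one element differ by a power \<open>x [^] (k - k')\<close> that
  lies in \<open>H\<close>. Agreement of \<open>w\<close> with \<open>\<chi>\<close> on such powers
  makes \<open>\<chi> h * w powi k\<close> independent of the representation, so the choice hidden
  in \<open>\<psi>\<close> is harmless.\<close>

lemma complex_character_extend:
  assumes H: "subgroup H G" and \<chi>: "complex_character H \<chi>" and x: "x \<in> carrier G"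
    and w: "w \<noteq> 0" "\<And>k::int. x [^] k \<in> H \<Longrightarrow> \<chi> (x [^] k) = w powi k"
  obtains \<psi> where "complex_character (adjoin H x) \<psi>"
    and "\<And>h k. h \<in> H \<Longrightarrow> \<psi> (h \<otimes> x [^] (k::int)) = \<chi> h * w powi k"
proof -
  define \<psi> where "\<psi> u = (let (h, k) = SOME (h, k::int). h \<in> H \<and> u = h \<otimes> x [^] k in \<chi> h * w powi k)" for u
  have wd: "\<chi> h * w powi k = \<chi> h' * w powi k'"
    if h: "h \<in> H" "h' \<in> H" and eq: "h \<otimes> x [^] k = h' \<otimes> x [^] k'" for h h' and k k' :: int
  proof -
    have hc: "h \<in> carrier G" "h' \<in> carrier G" using h H by (auto simp: subgroup.mem_carrier)
    have "x [^] (k - k') = inv h \<otimes> (h \<otimes> x [^] k) \<otimes> inv (x [^] k')"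
      using hc x by (simp add: int_pow_diff m_assoc[symmetric])
    also have "\<dots> = inv h \<otimes> h'"
      unfolding eq using hc x by (simp add: m_assoc)
    finally have *: "x [^] (k - k') = inv h \<otimes> h'" .
    moreover have "inv h \<otimes> h' \<in> H" using h H by (simp add: subgroup.m_closed subgroup.m_inv_closed)
    ultimately have "w powi (k - k') = inverse (\<chi> h) * \<chi> h'"
      using w(2)[of "k - k'"] h complex_characterD(2)[OF \<chi>] complex_character_inv[OF \<chi> H]
      by (simp add: subgroup.m_inv_closed[OF H])
    then show ?thesis
      using w(1) complex_characterD(1)[OF \<chi>] h by (simp add: power_int_diff field_simps)
  qed
  have \<psi>: "\<psi> (h \<otimes> x [^] k) = \<chi> h * w powi k" if "h \<in> H" for h and k :: int
  proof -
    define p where "p = (SOME (h', k'::int). h' \<in> H \<and> h \<otimes> x [^] k = h' \<otimes> x [^] k')"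
    have "case p of (h', k') \<Rightarrow> h' \<in> H \<and> h \<otimes> x [^] k = h' \<otimes> x [^] k'"
      unfolding p_def by (rule someI[of _ "(h, k)"]) (use that in auto)
    then show ?thesis
      using wd[OF that] unfolding \<psi>_def p_def[symmetric] by (auto split: prod.splits)
  qed
  show thesis
  proof (rule that)
    show "complex_character (adjoin H x) \<psi>"
      unfolding complex_character_def
    proof (intro conjI ballI)
      fix u assume "u \<in> adjoin H x"
      then show "\<psi> u \<noteq> 0"
        by (elim adjoinE) (use w(1) complex_characterD(1)[OF \<chi>] \<psi> in auto)
      fix v assume "v \<in> adjoin H x"
      then obtain h h' and k k' :: int
        where h: "h \<in> H" "u = h \<otimes> x [^] k" "h' \<in> H" "v = h' \<otimes> x [^] k'"
        using \<open>u \<in> adjoin H x\<close> by (elim adjoinE) blast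
      then show "\<psi> (u \<otimes> v) = \<psi> u * \<psi> v"
        using w(1) complex_characterD(2)[OF \<chi>] subgroup.m_closed[OF H]
        by (simp add: adjoin_mult[OF H x] \<psi> power_int_add)
    qed
  qed (rule \<psi>)
qed

definition torsion :: "'a set" where
  "torsion = {g \<in> carrier G. \<exists>n::nat. n \<ge> 1 \<and> g [^] n = \<one>}"

lemma countable_complex_roots: "n \<ge> 1 \<Longrightarrow> countable {z::complex. z ^ n = c}"
  using finite_nth_roots[of n c] by (intro countable_finite) simp

text \<open>Injectivity can be lost in an extension, since \<open>w\<close> may be an arbitrary root
  of a value of \<open>\<chi>\<close>; a kernel inside the torsion is the invariant that survives.
  If no positive power of \<open>x\<close> lies in \<open>H\<close>, countability of
  \<open>H\<close> leaves room for an independent value; otherwise \<open>\<chi>\<close> prescribes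
  a power of \<open>w\<close>.\<close>

lemma complex_character_extend_torsion_kernel:
  assumes H: "subgroup H G" "countable H" and \<chi>: "complex_character H \<chi>" and x: "x \<in> carrier G"
    and ker: "\<And>h. h \<in> H \<Longrightarrow> \<chi> h = 1 \<Longrightarrow> h \<in> torsion"
  obtains \<psi> where "complex_character (adjoin H x) \<psi>"
    and "\<And>h. h \<in> H \<Longrightarrow> \<psi> h = \<chi> h"
    and "\<And>h. h \<in> adjoin H x \<Longrightarrow> \<psi> h = 1 \<Longrightarrow> h \<in> torsion"
proof (cases "\<exists>n::nat. n \<ge> 1 \<and> x [^] n \<in> H")
  case False
  \<comment> \<open>\<open>x\<close> is independent of \<open>H\<close>, so its value may be any \<open>w\<close> with no positive power
    in the countable set \<open>\<chi> ` H\<close>\<close>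
  have pos: "x [^] n \<notin> H" if "n \<noteq> 0" for n :: nat
    using False that by (metis One_nat_def Suc_leI not_gr_zero)
  have k0: "k = 0" if k: "x [^] k \<in> H" for k :: int
  proof (cases k rule: int_cases2)
    case (nonneg n)
    then show ?thesis using k pos[of n] by (auto simp: int_pow_int)
  next
    case (nonpos n)
    then have "inv (x [^] n) \<in> H" using k x by (simp add: int_pow_neg int_pow_int)
    then have "inv (inv (x [^] n)) \<in> H" by (rule subgroup.m_inv_closed[OF H(1)])
    then show ?thesis using nonpos x pos[of n] by auto
  qed
  define B where "B = insert 0 (\<Union>(h, n)\<in>H \<times> {1::nat..}. {z::complex. z ^ n = \<chi> h})"
  have "countable B"
    unfolding B_def
  proof (intro countable_insert countable_UN)
    show "countable (H \<times> {1::nat..})" using H(2) by simp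
    show "countable (case p of (h, n) \<Rightarrow> {z. z ^ n = \<chi> h})" if "p \<in> H \<times> {1..}" for p
      using that countable_complex_roots by (cases p) simp
  qed
  then have "B \<noteq> UNIV" using uncountable_UNIV_complex by metis
  then obtain w where "w \<notin> B" by blast
  then have w0: "w \<noteq> 0" and w: "\<And>h n. h \<in> H \<Longrightarrow> n \<ge> 1 \<Longrightarrow> w ^ n \<noteq> \<chi> h"
    unfolding B_def by blast+
  have wk: "\<chi> (x [^] k) = w powi k" if "x [^] k \<in> H" for k :: int
    using k0[OF that] complex_character_one[OF \<chi> H(1)] by simp
  obtain \<psi> where \<psi>: "complex_character (adjoin H x) \<psi>"
    "\<And>h k. h \<in> H \<Longrightarrow> \<psi> (h \<otimes> x [^] (k::int)) = \<chi> h * w powi k"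
    using complex_character_extend[OF H(1) \<chi> x w0 wk] by blast
  show thesis
  proof (rule that[OF \<psi>(1)])
    fix h assume h: "h \<in> H"
    show "\<psi> h = \<chi> h" using \<psi>(2)[OF h, of 0] subgroup.mem_carrier[OF H(1) h] by simp
  next
    fix u assume u: "u \<in> adjoin H x" and u1: "\<psi> u = 1"
    obtain h and k :: int where h: "h \<in> H" "u = h \<otimes> x [^] k" using u by (elim adjoinE)
    have eq: "\<chi> h * w powi k = 1" using u1 h \<psi>(2) by simp
    \<comment> \<open>A nonzero \<open>k\<close> would make a positive power of \<open>w\<close>
      equal to \<open>\<chi> (inv h)\<close> or to \<open>\<chi> h\<close>, according to its sign;
      the choice of \<open>w\<close> outside \<open>B\<close> excludes both.\<close>
    have "k = 0"
    proof (rule ccontr)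
      assume "k \<noteq> 0"
      show False
      proof (cases "k > 0")
        case True
        have "w ^ nat k = \<chi> (inv h)"
          using inverse_unique[OF eq] True complex_character_inv[OF \<chi> H(1) h(1)]
          by (simp add: power_int_def)
        then show False using w[of "inv h" "nat k"] True subgroup.m_inv_closed[OF H(1) h(1)] by simp
      next
        case False
        have "w ^ nat (- k) = \<chi> h"
          using inverse_unique[OF eq] False \<open>k \<noteq> 0\<close>
          by (simp add: power_int_def) (simp add: power_inverse)
        then show False using w[of h "nat (- k)"] False \<open>k \<noteq> 0\<close> h(1) by simp
      qed
    qed
    then show "u \<in> torsion" using h eq ker subgroup.mem_carrier[OF H(1) h(1)] by simp
  qed
next
  case True
  \<comment> \<open>The powers of \<open>x\<close> inside \<open>H\<close> are exactly the powers of
    \<open>x [^] d\<close>, so any \<open>d\<close>-th root of \<open>\<chi> (x [^] d)\<close> is a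
    consistent value for \<open>x\<close>.\<close>
  define d where "d = (LEAST n::nat. n \<ge> 1 \<and> x [^] n \<in> H)"
  have d: "d \<ge> 1" "x [^] d \<in> H" using LeastI_ex[OF True] by (auto simp: d_def)
  have dleast: "d \<le> n" if "n \<ge> 1" "x [^] n \<in> H" for n unfolding d_def by (rule Least_le) (use that in auto)
  obtain w where w: "w ^ d = \<chi> (x [^] d)"
    using card_nth_roots[of "\<chi> (x [^] d)" d] complex_characterD(1)[OF \<chi> d(2)] d(1)
    by (cases "{z. z ^ d = \<chi> (x [^] d)} = {}") auto
  have w0: "w \<noteq> 0" using w d complex_characterD(1)[OF \<chi> d(2)] by (metis One_nat_def not_one_le_zero power_0_left)
  have wk: "\<chi> (x [^] k) = w powi k" if k: "x [^] k \<in> H" for k :: int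
  proof -
    \<comment> \<open>Division with remainder: \<open>x [^] r\<close> lies in \<open>H\<close> as
      well, and minimality of \<open>d\<close> forces \<open>r = 0\<close>.\<close>
    define q r where "q = k div int d" and "r = nat (k mod int d)"
    have kqr: "k = int d * q + int r" and rd: "r < d"
      using d(1) by (auto simp: q_def r_def nat_less_iff)
    have xdq: "x [^] (int d * q) = (x [^] d) [^] q"
      using x by (simp add: int_pow_pow flip: int_pow_int)
    have "(x [^] d) [^] q \<in> H" using H(1) d(2) by (simp add: subgroup_int_pow_closed)
    moreover have "x [^] int r = inv ((x [^] d) [^] q) \<otimes> x [^] k"
      using x unfolding kqr xdq[symmetric] by (simp add: int_pow_mult m_assoc[symmetric])
    ultimately have "x [^] r \<in> H"
      using H(1) k by (simp add: subgroup.m_closed subgroup.m_inv_closed int_pow_int)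
    then have "r = 0" using dleast[of r] rd by (cases r) auto
    then have "\<chi> (x [^] k) = \<chi> ((x [^] d) [^] q)" using kqr xdq by simp
    also have "\<dots> = \<chi> (x [^] d) powi q"
    proof (cases q rule: int_cases2)
      case (nonneg n)
      then show ?thesis
        using complex_character_nat_pow[OF \<chi> H(1) d(2)] by (simp add: int_pow_int)
    next
      case (nonpos n)
      have "(x [^] d) [^] n \<in> H"
        using subgroup_int_pow_closed[OF H(1) d(2), of "int n"] by (simp only: int_pow_int)
      with nonpos show ?thesis
        using complex_character_nat_pow[OF \<chi> H(1) d(2)] complex_character_inv[OF \<chi> H(1)] x
        by (simp add: int_pow_neg int_pow_int power_int_minus)
    qed
    also have "\<dots> = w powi k"
      using \<open>r = 0\<close> by (simp add: kqr power_int_mult flip: w)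
    finally show ?thesis .
  qed
  obtain \<psi> where \<psi>: "complex_character (adjoin H x) \<psi>"
    "\<And>h k. h \<in> H \<Longrightarrow> \<psi> (h \<otimes> x [^] (k::int)) = \<chi> h * w powi k"
    using complex_character_extend[OF H(1) \<chi> x w0 wk] by blast
  have ext: "\<psi> h = \<chi> h" if h: "h \<in> H" for h
    using \<psi>(2)[OF h, of 0] subgroup.mem_carrier[OF H(1) h] by simp
  show thesis
  proof (rule that[OF \<psi>(1) ext])
    fix u assume u: "u \<in> adjoin H x" and u1: "\<psi> u = 1"
    note A = subgroup_adjoin[OF H(1) x]
    have uc: "u \<in> carrier G" using subgroup.mem_carrier[OF A u] .
    obtain h and k :: int where h: "h \<in> H" "u = h \<otimes> x [^] k" using u by (elim adjoinE)
    have hc: "h \<in> carrier G" using subgroup.mem_carrier[OF H(1) h(1)] .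
    \<comment> \<open>The power \<open>u [^] d\<close> falls back into \<open>H\<close>, where the
      kernel of \<open>\<chi>\<close> is torsion; hence \<open>u [^] d\<close>, and with it
      \<open>u\<close>, is torsion.\<close>
    have "(x [^] k) [^] int d = (x [^] int d) [^] k"
      using x by (simp only: int_pow_pow mult.commute)
    then have "u [^] d = h [^] d \<otimes> (x [^] d) [^] k"
      using h hc x by (simp add: nat_pow_distrib int_pow_int)
    also have "\<dots> \<in> H"
      using subgroup_int_pow_closed[OF H(1) h(1), of "int d"] subgroup_int_pow_closed[OF H(1) d(2), of k] H(1)
      by (simp add: subgroup.m_closed int_pow_int)
    finally have udH: "u [^] d \<in> H" .
    moreover have "\<chi> (u [^] d) = 1"
      using ext[OF udH] complex_character_nat_pow[OF \<psi>(1) A u] u1 by simp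
    ultimately have "u [^] d \<in> torsion" by (rule ker)
    then obtain n :: nat where "n \<ge> 1" "u [^] (d * n) = \<one>" using uc by (auto simp: torsion_def nat_pow_pow)
    then show "u \<in> torsion" using d(1) uc by (auto simp: torsion_def intro!: exI[of _ "d * n"])
  qed
qed

end

section \<open>Cyclicity of root subgroups\<close>

lemma (in comm_group) ord_mult_coprime:
  assumes xy: "x \<in> carrier G" "y \<in> carrier G" and cop: "coprime (ord x) (ord y)"
  shows "ord (x \<otimes> y) = ord x * ord y"
proof (rule dvd_antisym)
  show "ord (x \<otimes> y) dvd ord x * ord y" using xy by (rule abelian_ord_mul_divides)
  \<comment> \<open>The exponent \<open>ord (u \<otimes> v) * ord v\<close> kills both
    \<open>u \<otimes> v\<close> and \<open>v\<close>, hence \<open>u\<close>; coprimality then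
    removes the factor \<open>ord v\<close>.\<close>
  have dvd: "ord u dvd ord (u \<otimes> v)"
    if uv: "u \<in> carrier G" "v \<in> carrier G" "coprime (ord u) (ord v)" for u v
  proof -
    have "u [^] (ord (u \<otimes> v) * ord v) = (u \<otimes> v) [^] (ord (u \<otimes> v) * ord v)"
      using uv by (simp add: nat_pow_distrib pow_eq_id)
    also have "\<dots> = \<one>" using uv by (simp add: pow_eq_id)
    finally have "ord u dvd ord (u \<otimes> v) * ord v" using uv by (simp add: pow_eq_id)
    then show ?thesis using uv(3) by (simp add: coprime_dvd_mult_left_iff)
  qed
  have "ord y dvd ord (x \<otimes> y)"
    using dvd[of y x] xy cop by (simp add: coprime_commute m_comm)
  with dvd[OF xy cop] show "ord x * ord y dvd ord (x \<otimes> y)" using cop by (simp add: divides_mult)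
qed

lemma (in comm_group) root_subgroup:
  "subgroup {g \<in> carrier G. g [^] (n::nat) = \<one>} G"
  by (rule subgroupI) (auto simp: nat_pow_distrib nat_pow_inv intro!: exI[of _ \<one>])

text \<open>As for finite subgroups of the units of a field: for \<open>z\<close> of maximal order
  all orders in \<open>T\<close> divide \<open>ord z\<close>, so \<open>T\<close> consists of
  solutions of \<open>g [^] ord z = \<one>\<close>. There are at most \<open>ord z\<close> of these,
  and the powers of \<open>z\<close> already supply that many.\<close>

lemma (in comm_group) finite_root_subgroup_cyclic:
  assumes N: "(N::nat) \<ge> 1"
    and roots: "\<And>n::nat. n \<ge> 1 \<Longrightarrow>
      finite {g \<in> carrier G. g [^] n = \<one>} \<and> card {g \<in> carrier G. g [^] n = \<one>} \<le> n"
  obtains z where "z \<in> carrier G" "ord z \<ge> 1" "{g \<in> carrier G. g [^] N = \<one>} = (\<lambda>k::nat. z [^] k) ` {..<ord z}"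
proof -
  define T where "T = {g \<in> carrier G. g [^] N = \<one>}"
  have finT: "finite T" and T1: "\<one> \<in> T" using roots[OF N] by (auto simp: T_def)
  have ordT: "ord g dvd N" "ord g \<ge> 1" if "g \<in> T" for g
  proof -
    show "ord g dvd N" using that by (simp add: T_def flip: pow_eq_id)
    then show "ord g \<ge> 1" using N by (metis One_nat_def Suc_leI dvd_0_left_iff not_gr_zero not_one_le_zero)
  qed
  obtain z where z: "z \<in> T" and zmax: "\<And>g. g \<in> T \<Longrightarrow> ord g \<le> ord z"
  proof -
    have "Max (ord ` T) \<in> ord ` T" using finT T1 by (intro Max_in) auto
    then obtain z where "z \<in> T" "ord z = Max (ord ` T)" by auto
    then show thesis using that finT by simp
  qed
  have zc: "z \<in> carrier G" using z by (simp add: T_def)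
  have Tmult: "g \<otimes> h \<in> T" if "g \<in> T" "h \<in> T" for g h
    using that by (simp add: T_def nat_pow_distrib)
  have Tpow: "g [^] k \<in> T" if "g \<in> T" for g and k :: nat
    using that by (simp add: T_def nat_pow_pow) (metis mult.commute nat_pow_one nat_pow_pow)
  \<comment> \<open>otherwise a prime that divides \<open>ord g\<close> to a higher power than \<open>ord z\<close> yields an element of larger order\<close>
  have dvd: "ord g dvd ord z" if g: "g \<in> T" for g
  proof (rule ccontr)
    assume "\<not> ord g dvd ord z"
    then obtain p where p: "Factorial_Ring.prime p" "multiplicity p (ord z) < multiplicity p (ord g)"
      using multiplicity_le_imp_dvd[of "ord g" "ord z"] ordT[OF g] ordT[OF z]
      by (metis not_le not_one_le_zero)
    define a b where "a = multiplicity p (ord z)" and "b = multiplicity p (ord g)"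
    obtain u where u: "ord z = p ^ a * u" "\<not> p dvd u"
      using multiplicity_decompose'[of "ord z" p] p(1) ordT[OF z] unfolding a_def
      by (metis not_one_le_zero not_prime_unit)
    obtain v where v: "ord g = p ^ b * v"
      using multiplicity_dvd[of p "ord g"] unfolding b_def by (auto elim: dvdE)
    have pos: "p > 0" "u > 0" "v > 0" using p(1) prime_gt_0_nat u v ordT[OF z] ordT[OF g]
      by (auto intro!: Nat.gr0I)
    have gc: "g \<in> carrier G" using g by (simp add: T_def)
    \<comment> \<open>Taking powers strips \<open>z\<close> of the \<open>p\<close>-part of its
      order and leaves \<open>g\<close> with only the \<open>p\<close>-part. The orders
      \<open>u\<close> and \<open>p ^ b\<close> are coprime, and their product exceeds
      \<open>ord z = p ^ a * u\<close> because \<open>a < b\<close>.\<close>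
    have "ord (z [^] (p ^ a)) = u" using ord_pow[OF zc, of "p ^ a"] u pos by simp
    moreover have "ord (g [^] v) = p ^ b" using ord_pow[OF gc, of v] v pos by simp
    moreover have "coprime u (p ^ b)"
      using p(1) u(2) by (meson coprime_commute coprime_power_left_iff prime_imp_coprime)
    ultimately have "ord (z [^] (p ^ a) \<otimes> g [^] v) = u * p ^ b"
      using ord_mult_coprime[of "z [^] (p ^ a)" "g [^] v"] zc gc by simp
    moreover have "z [^] (p ^ a) \<otimes> g [^] v \<in> T" using Tmult Tpow z g by simp
    ultimately have "u * p ^ b \<le> ord z" using zmax by metis
    then have "p ^ b \<le> p ^ a" using u(1) pos by (simp add: mult.commute)
    then show False using p prime_gt_1_nat by (simp add: a_def b_def)
  qed
  define Z where "Z = (\<lambda>k::nat. z [^] k) ` {..<ord z}"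
  have "inj_on (\<lambda>k::nat. z [^] k) {..<ord z}"
    using ord_inj[OF zc] by (rule inj_on_subset) auto
  then have cardZ: "card Z = ord z" by (simp add: Z_def card_image)
  have ZT: "Z \<subseteq> T" using Tpow[OF z] by (auto simp: Z_def)
  have "T \<subseteq> {g \<in> carrier G. g [^] ord z = \<one>}"
    using dvd by (auto simp: T_def pow_eq_id)
  then have "card T \<le> ord z"
    using roots[OF ordT(2)[OF z]] by (meson card_mono le_trans)
  then have "Z = T" using ZT finT cardZ by (intro card_seteq) auto
  then show thesis using that[OF zc ordT(2)[OF z]] by (simp add: T_def Z_def)
qed

text \<open>For \<open>w = cis (2 * pi / n)\<close> integer exponents may be reduced modulo
  \<open>n\<close>, and the powers with exponent below \<open>n\<close> are the distinct
  \<open>n\<close>-th roots of unity.\<close>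

lemma primitive_complex_root:
  assumes "n \<ge> 1"
  obtains w :: complex where "w \<noteq> 0" "\<And>k::int. w powi k = 1 \<longleftrightarrow> int n dvd k"
proof -
  define w where "w = cis (2 * pi / real n)"
  have pw: "w ^ k = cis (2 * pi * real k / real n)" for k
    by (simp add: w_def DeMoivre mult_ac)
  have wn: "w ^ n = 1" using pw[of n] assms by simp
  have w0: "w \<noteq> 0" by (simp add: w_def)
  have inj: "inj_on (\<lambda>k. w ^ k) {..<n}"
    using bij_betw_roots_unity[of n] assms unfolding pw by (simp add: bij_betw_def)
  have "w powi k = 1 \<longleftrightarrow> int n dvd k" for k :: int
  proof -
    have "w powi k = w powi (int n * (k div int n) + k mod int n)" by simp
    also have "\<dots> = (w ^ n) powi (k div int n) * w powi (k mod int n)"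
      by (subst power_int_add) (use w0 in \<open>simp_all only: power_int_mult power_int_of_nat simp_thms\<close>)
    also have "\<dots> = w ^ nat (k mod int n)" using assms by (simp add: wn power_int_def)
    finally have "w powi k = 1 \<longleftrightarrow> w ^ nat (k mod int n) = w ^ 0" by simp
    also have "\<dots> \<longleftrightarrow> nat (k mod int n) = 0"
      using inj assms by (intro inj_on_eq_iff[OF inj]) (auto simp: nat_less_iff)
    also have "\<dots> \<longleftrightarrow> int n dvd k" using assms pos_mod_sign[of "int n" k] by (simp only: dvd_eq_mod_eq_0) linarith
    finally show ?thesis .
  qed
  then show thesis using that w0 by blast
qed

section \<open>Characters that are injective on a finite set\<close>

context comm_group
begin

text \<open>The subgroup is cyclic with generator \<open>z\<close>; sending \<open>z\<close> to a
  primitive root of unity of order \<open>ord z\<close> is faithful. This arises as an extension of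
  the trivial character of the trivial subgroup.\<close>

lemma complex_character_root_subgroup:
  assumes N: "(N::nat) \<ge> 1"
    and roots: "\<And>n::nat. n \<ge> 1 \<Longrightarrow>
      finite {g \<in> carrier G. g [^] n = \<one>} \<and> card {g \<in> carrier G. g [^] n = \<one>} \<le> n"
  obtains \<chi> where "complex_character {g \<in> carrier G. g [^] N = \<one>} \<chi>"
    "\<And>g. g \<in> carrier G \<Longrightarrow> g [^] N = \<one> \<Longrightarrow> \<chi> g = 1 \<Longrightarrow> g = \<one>"
proof -
  obtain z where z: "z \<in> carrier G" "ord z \<ge> 1"
    and T: "{g \<in> carrier G. g [^] N = \<one>} = (\<lambda>k::nat. z [^] k) ` {..<ord z}"
    using finite_root_subgroup_cyclic[OF N roots] by blast
  obtain w :: complex where w: "w \<noteq> 0" "\<And>k::int. w powi k = 1 \<longleftrightarrow> int (ord z) dvd k"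
    using primitive_complex_root[OF z(2)] by blast
  have triv: "complex_character {\<one>} (\<lambda>_. 1)" by (simp add: complex_character_def)
  have "w powi k = 1" if "z [^] k \<in> {\<one>}" for k :: int
    using that z(1) w(2) by (simp add: int_pow_eq_id)
  then obtain \<psi> where \<psi>: "complex_character (adjoin {\<one>} z) \<psi>"
    "\<And>k::int. \<psi> (\<one> \<otimes> z [^] k) = 1 * w powi k"
    using complex_character_extend[OF triv_subgroup triv z(1) w(1)] by (metis singletonI)
  have zk: "z [^] k \<in> adjoin {\<one>} z" for k :: nat
    using adjoinI[of \<one> "{\<one>}" z "int k"] z(1) by (simp add: int_pow_int)
  show thesis
  proof (rule that)
    show "complex_character {g \<in> carrier G. g [^] N = \<one>} \<psi>"
      using \<psi>(1) zk unfolding T complex_character_def by blast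
  next
    fix g assume "g \<in> carrier G" "g [^] N = \<one>" and g1: "\<psi> g = 1"
    then obtain k :: nat where k: "g = z [^] k" using T by blast
    then have "w powi int k = 1" using \<psi>(2)[of "int k"] z(1) g1 by (simp add: int_pow_int)
    then show "g = \<one>" using w(2)[of "int k"] z(1) k by (simp add: pow_eq_id)
  qed
qed

text \<open>Induction on \<open>F\<close>, adjoining one element at a time. Countability of the
  domain is carried along because the next extension needs it to find an independent value.\<close>

lemma complex_character_extend_finite:
  assumes "finite F" "F \<subseteq> carrier G" and H: "subgroup H G" "countable H" and \<chi>: "complex_character H \<chi>"
    and ker: "\<And>h. h \<in> H \<Longrightarrow> \<chi> h = 1 \<Longrightarrow> h \<in> torsion"
  shows "\<exists>K \<psi>. subgroup K G \<and> countable K \<and> H \<union> F \<subseteq> K \<and> complex_character K \<psi> \<and>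
    (\<forall>h\<in>H. \<psi> h = \<chi> h) \<and> (\<forall>h\<in>K. \<psi> h = 1 \<longrightarrow> h \<in> torsion)"
  using assms(1,2)
proof (induction F rule: finite_induct)
  case empty
  show ?case using H \<chi> ker by (intro exI[of _ H] exI[of _ \<chi>]) simp
next
  case (insert x F)
  then obtain K \<psi> where K: "subgroup K G" "countable K" "H \<union> F \<subseteq> K" "complex_character K \<psi>"
    "\<And>h. h\<in>H \<Longrightarrow> \<psi> h = \<chi> h" "\<And>h. h \<in> K \<Longrightarrow> \<psi> h = 1 \<Longrightarrow> h \<in> torsion" by auto
  have x: "x \<in> carrier G" using insert.prems by simp
  obtain \<phi> where \<phi>: "complex_character (adjoin K x) \<phi>" "\<And>h. h \<in> K \<Longrightarrow> \<phi> h = \<psi> h"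
    "\<And>h. h \<in> adjoin K x \<Longrightarrow> \<phi> h = 1 \<Longrightarrow> h \<in> torsion"
    using complex_character_extend_torsion_kernel[OF K(1,2,4) x K(6)] by blast
  show ?case
    using subgroup_adjoin[OF K(1) x] countable_adjoin[OF K(2)] subset_adjoin[OF K(1) x] K(3,5) \<phi>
    by (intro exI[of _ "adjoin K x"] exI[of _ \<phi>]) auto
qed

text \<open>A torsion kernel alone does not separate \<open>F\<close>. The extension therefore
  starts from a faithful character of a root subgroup \<open>T\<close> that contains
  \<open>D\<close>, the torsion quotients of elements of \<open>F\<close>.\<close>

lemma complex_character_separating_finite:
  assumes F: "finite F" "F \<subseteq> carrier G"
    and roots: "\<And>n::nat. n \<ge> 1 \<Longrightarrow>
      finite {g \<in> carrier G. g [^] n = \<one>} \<and> card {g \<in> carrier G. g [^] n = \<one>} \<le> n"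
  obtains K \<psi> where "subgroup K G" "F \<subseteq> K" "complex_character K \<psi>" "inj_on \<psi> F"
proof -
  define D where "D = (\<lambda>(f, g). f \<otimes> inv g) ` (F \<times> F) \<inter> torsion"
  have "finite D" using F by (simp add: D_def)
  have "\<exists>N\<ge>1. \<forall>g\<in>D. g [^] (N::nat) = \<one>"
  proof -
    have "\<forall>g\<in>D. \<exists>n::nat. n \<ge> 1 \<and> g [^] n = \<one>" by (auto simp: D_def torsion_def)
    then obtain e :: "'a \<Rightarrow> nat" where e: "\<And>g. g \<in> D \<Longrightarrow> e g \<ge> 1 \<and> g [^] e g = \<one>" by metis
    \<comment> \<open>Any common multiple of the finitely many exponents \<open>e g\<close> may
      serve as \<open>N\<close>; their product is one.\<close>
    have "g [^] prod e D = \<one>" if "g \<in> D" for g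
    proof -
      have "g \<in> carrier G" using that by (simp add: D_def torsion_def)
      moreover have "e g dvd prod e D" using \<open>finite D\<close> that by (rule dvd_prodI)
      ultimately show ?thesis using e[OF that] by (metis dvd_trans pow_eq_id)
    qed
    moreover have "prod e D \<ge> 1" using e by (metis One_nat_def Suc_leI not_gr_zero not_one_le_zero prod_zero_iff \<open>finite D\<close>)
    ultimately show ?thesis by blast
  qed
  then obtain N :: nat where N: "N \<ge> 1" "\<And>g. g \<in> D \<Longrightarrow> g [^] N = \<one>" by blast
  define T where "T = {g \<in> carrier G. g [^] N = \<one>}"
  obtain \<chi> where \<chi>T: "complex_character T \<chi>"
    and ker: "\<And>g. g \<in> carrier G \<Longrightarrow> g [^] N = \<one> \<Longrightarrow> \<chi> g = 1 \<Longrightarrow> g = \<one>"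
    using complex_character_root_subgroup[OF N(1) roots] unfolding T_def by blast
  have \<chi>1: "g = \<one>" if "g \<in> T" "\<chi> g = 1" for g using ker[of g] that by (simp add: T_def)
  have T: "subgroup T G" unfolding T_def by (rule root_subgroup)
  have cT: "countable T" using roots[OF N(1)] by (simp add: T_def countable_finite)
  have tor: "\<one> \<in> torsion" by (auto simp: torsion_def)
  obtain K \<psi> where K: "subgroup K G" "T \<union> F \<subseteq> K" "complex_character K \<psi>"
    "\<And>h. h \<in> T \<Longrightarrow> \<psi> h = \<chi> h" "\<And>h. h \<in> K \<Longrightarrow> \<psi> h = 1 \<Longrightarrow> h \<in> torsion"
    using complex_character_extend_finite[OF F T cT \<chi>T] \<chi>1 tor by metis
  \<comment> \<open>If \<open>\<psi> f = \<psi> g\<close>, then \<open>f \<otimes> inv g\<close> is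
    in the kernel, so it is torsion, so it lies in \<open>D\<close> and hence in \<open>T\<close>.
    There \<open>\<psi>\<close> agrees with the faithful \<open>\<chi>\<close>.\<close>
  have "inj_on \<psi> F"
  proof (rule inj_onI)
    fix f g assume fg: "f \<in> F" "g \<in> F" and eq: "\<psi> f = \<psi> g"
    have fgK: "f \<in> K" "inv g \<in> K" "g \<in> K" using fg K(1,2) by (auto simp: subgroup.m_inv_closed)
    have c: "f \<in> carrier G" "g \<in> carrier G" using fg F by auto
    have uK: "f \<otimes> inv g \<in> K" using fgK K(1) by (simp add: subgroup.m_closed)
    have u1: "\<psi> (f \<otimes> inv g) = 1"
      using complex_characterD[OF K(3)] complex_character_inv[OF K(3,1)] fgK eq by simp
    have "f \<otimes> inv g \<in> torsion" using K(5) uK u1 by blast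
    then have "f \<otimes> inv g \<in> D" using fg by (auto simp: D_def)
    then have "f \<otimes> inv g \<in> T" using N(2) c by (simp add: T_def)
    then have "f \<otimes> inv g = \<one>" using \<chi>1 K(4) u1 by metis
    then show "f = g" using c inv_equality[of f "inv g"] by simp
  qed
  then show thesis using that K(1-3) by blast
qed

end

section \<open>Group completion\<close>

locale cancel_comm_monoid = comm_monoid M for M (structure) +
  assumes l_cancel: "a \<in> carrier M \<Longrightarrow> b \<in> carrier M \<Longrightarrow> c \<in> carrier M \<Longrightarrow> a \<otimes> b = a \<otimes> c \<Longrightarrow> b = c"
begin

text \<open>The class of the formal quotient a/b, as the set of all pairs equivalent to
  \<open>(a, b)\<close> under cross-multiplication.\<close>

definition fraction :: "'a \<Rightarrow> 'a \<Rightarrow> ('a \<times> 'a) set" where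
  "fraction a b = {(x, y). x \<in> carrier M \<and> y \<in> carrier M \<and> a \<otimes> y = b \<otimes> x}"

text \<open>Elements are whole classes, so equal fractions are equal sets. The product uses
  arbitrarily chosen representatives; \<open>fraction_mult\<close> shows that the choice does not
  matter.\<close>

definition group_completion :: "('a \<times> 'a) set monoid" where
  "group_completion = \<lparr>carrier = (\<lambda>(a, b). fraction a b) ` (carrier M \<times> carrier M),
     monoid.mult = \<lambda>g h. let (a, b) = SOME p. p \<in> g; (c, d) = SOME p. p \<in> h in fraction (a \<otimes> c) (b \<otimes> d),
     one = fraction \<one> \<one>\<rparr>"

text \<open>This is transitivity of cross-multiplication, and the place where cancellation enters:
  it removes the factor \<open>b\<close>.\<close>

lemma fraction_subset:
  assumes c: "a \<in> carrier M" "b \<in> carrier M" "c \<in> carrier M" "d \<in> carrier M"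
    and eq: "a \<otimes> d = b \<otimes> c"
  shows "fraction a b \<subseteq> fraction c d"
proof
  fix p assume "p \<in> fraction a b"
  then obtain x y where p: "p = (x, y)" and xy: "x \<in> carrier M" "y \<in> carrier M" "a \<otimes> y = b \<otimes> x"
    by (auto simp: fraction_def)
  have "b \<otimes> (c \<otimes> y) = (a \<otimes> d) \<otimes> y" using c xy eq by (simp add: m_assoc)
  also have "\<dots> = (a \<otimes> y) \<otimes> d" using c xy(1,2) by (simp add: m_ac)
  also have "\<dots> = b \<otimes> (d \<otimes> x)" unfolding xy(3) using c xy(1,2) by (simp add: m_ac)
  finally have "c \<otimes> y = d \<otimes> x" using c xy l_cancel[of b "c \<otimes> y" "d \<otimes> x"] by simp
  then show "p \<in> fraction c d" using p xy by (simp add: fraction_def)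
qed

lemma fraction_eq_iff:
  assumes "a \<in> carrier M" "b \<in> carrier M" "c \<in> carrier M" "d \<in> carrier M"
  shows "fraction a b = fraction c d \<longleftrightarrow> a \<otimes> d = b \<otimes> c"
proof
  assume "fraction a b = fraction c d"
  moreover have "(c, d) \<in> fraction c d" using assms by (simp add: fraction_def m_comm)
  ultimately show "a \<otimes> d = b \<otimes> c" by (auto simp: fraction_def)
next
  assume "a \<otimes> d = b \<otimes> c"
  then show "fraction a b = fraction c d"
    using assms by (intro equalityI fraction_subset) (simp_all add: m_comm)
qed

lemma group_completion_one: "\<one>\<^bsub>group_completion\<^esub> = fraction \<one> \<one>"
  by (simp add: group_completion_def)

lemma fraction_closed:
  "a \<in> carrier M \<Longrightarrow> b \<in> carrier M \<Longrightarrow> fraction a b \<in> carrier group_completion"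
  by (auto simp: group_completion_def)

lemma group_completionE:
  assumes "g \<in> carrier group_completion"
  obtains a b where "a \<in> carrier M" "b \<in> carrier M" "g = fraction a b"
  using assms by (auto simp: group_completion_def)

lemma fraction_mult:
  assumes "a \<in> carrier M" "b \<in> carrier M" "c \<in> carrier M" "d \<in> carrier M"
  shows "fraction a b \<otimes>\<^bsub>group_completion\<^esub> fraction c d = fraction (a \<otimes> c) (b \<otimes> d)"
proof -
  have rep: "\<exists>x y. (SOME p. p \<in> fraction u v) = (x, y) \<and> x \<in> carrier M \<and> y \<in> carrier M \<and> u \<otimes> y = v \<otimes> x"
    if "u \<in> carrier M" "v \<in> carrier M" for u v
  proof -
    have "(u, v) \<in> fraction u v" using that by (simp add: fraction_def m_comm)
    then have "(SOME p. p \<in> fraction u v) \<in> fraction u v" by (rule someI)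
    then show ?thesis by (auto simp: fraction_def)
  qed
  obtain x y where x: "(SOME p. p \<in> fraction a b) = (x, y)" "x \<in> carrier M" "y \<in> carrier M" "a \<otimes> y = b \<otimes> x"
    using rep[OF assms(1,2)] by blast
  obtain z w where z: "(SOME p. p \<in> fraction c d) = (z, w)" "z \<in> carrier M" "w \<in> carrier M" "c \<otimes> w = d \<otimes> z"
    using rep[OF assms(3,4)] by blast
  have "(a \<otimes> c) \<otimes> (y \<otimes> w) = (a \<otimes> y) \<otimes> (c \<otimes> w)" using assms x(2,3) z(2,3) by (simp add: m_ac)
  also have "\<dots> = (b \<otimes> d) \<otimes> (x \<otimes> z)" unfolding x(4) z(4) using assms x(2,3) z(2,3) by (simp add: m_ac)
  finally have "fraction (x \<otimes> z) (y \<otimes> w) = fraction (a \<otimes> c) (b \<otimes> d)"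
    using assms x(2,3) z(2,3) by (subst fraction_eq_iff) (simp_all add: m_comm)
  then show ?thesis by (simp add: group_completion_def x(1) z(1))
qed

lemma comm_group_group_completion: "comm_group group_completion"
proof (rule comm_groupI)
  fix g assume "g \<in> carrier group_completion"
  then obtain a b where g: "a \<in> carrier M" "b \<in> carrier M" "g = fraction a b" by (rule group_completionE)
  then show "\<one>\<^bsub>group_completion\<^esub> \<otimes>\<^bsub>group_completion\<^esub> g = g"
    by (simp add: group_completion_one fraction_mult)
  show "\<exists>h\<in>carrier group_completion. h \<otimes>\<^bsub>group_completion\<^esub> g = \<one>\<^bsub>group_completion\<^esub>"
    using g by (intro bexI[of _ "fraction b a"])
      (simp_all add: group_completion_one fraction_mult fraction_closed fraction_eq_iff m_comm)
qed (auto elim!: group_completionE simp: group_completion_one fraction_mult fraction_closed m_ac)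

definition of_monoid :: "'a \<Rightarrow> ('a \<times> 'a) set" where
  "of_monoid a = fraction a \<one>"

lemma of_monoid_closed: "a \<in> carrier M \<Longrightarrow> of_monoid a \<in> carrier group_completion"
  by (simp add: of_monoid_def fraction_closed)

lemma of_monoid_mult:
  "a \<in> carrier M \<Longrightarrow> b \<in> carrier M \<Longrightarrow>
    of_monoid (a \<otimes> b) = of_monoid a \<otimes>\<^bsub>group_completion\<^esub> of_monoid b"
  by (simp add: of_monoid_def fraction_mult)

lemma of_monoid_one: "of_monoid \<one> = \<one>\<^bsub>group_completion\<^esub>"
  by (simp add: of_monoid_def group_completion_one)

lemma inj_on_of_monoid: "inj_on of_monoid (carrier M)"
  by (rule inj_onI) (simp add: of_monoid_def fraction_eq_iff)

lemma fraction_pow: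
  assumes "a \<in> carrier M" "b \<in> carrier M"
  shows "fraction a b [^]\<^bsub>group_completion\<^esub> (n::nat) = fraction (a [^] n) (b [^] n)"
  using assms by (induction n) (simp_all add: group_completion_one fraction_mult)

section \<open>Roots of unity in the group completion\<close>

lemma common_denominator:
  assumes "finite S" "S \<subseteq> carrier group_completion"
  shows "\<exists>b\<in>carrier M. \<forall>g\<in>S. \<exists>a\<in>carrier M. g = fraction a b"
  using assms
proof (induction S rule: finite_induct)
  case empty
  then show ?case by auto
next
  case (insert g S)
  then obtain b where b: "b \<in> carrier M" "\<And>h. h \<in> S \<Longrightarrow> \<exists>a\<in>carrier M. h = fraction a b" by auto
  obtain x y where g: "x \<in> carrier M" "y \<in> carrier M" "g = fraction x y"
    using insert.prems by (auto elim: group_completionE)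
  \<comment> \<open>The old common denominator \<open>b\<close> and the denominator \<open>y\<close>
    of the new element are both expanded to \<open>b \<otimes> y\<close>.\<close>
  have "\<exists>a\<in>carrier M. h = fraction a (b \<otimes> y)" if "h \<in> insert g S" for h
  proof (cases "h = g")
    case True
    then show ?thesis using g b(1) by (intro bexI[of _ "b \<otimes> x"]) (simp_all add: fraction_eq_iff m_ac)
  next
    case False
    then have "h \<in> S" using that by simp
    then obtain a where a: "a \<in> carrier M" "h = fraction a b" using b(2) by blast
    then have "h = fraction (a \<otimes> y) (b \<otimes> y)" using g(2) b(1) by (simp add: fraction_eq_iff m_ac)
    then show ?thesis using a(1) g(2) by blast
  qed
  then show ?case using b(1) g(2) by blast
qed

text \<open>Over a common denominator \<open>b\<close>, roots of unity a/b correspond to solutions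
  of \<open>a [^] n = b [^] n\<close> in \<open>M\<close>, where the bound is known. Common
  denominators exist only for finite sets, so all finite subsets are bounded by \<open>n\<close>,
  which also yields finiteness of the whole set.\<close>

lemma group_completion_roots:
  assumes n: "n \<ge> 1"
    and roots: "\<And>\<alpha>. \<alpha> \<in> carrier M \<Longrightarrow>
      finite {x \<in> carrier M. x [^] n = \<alpha>} \<and> card {x \<in> carrier M. x [^] (n::nat) = \<alpha>} \<le> n"
  shows "finite {g \<in> carrier group_completion. g [^]\<^bsub>group_completion\<^esub> n = \<one>\<^bsub>group_completion\<^esub>} \<and>
    card {g \<in> carrier group_completion. g [^]\<^bsub>group_completion\<^esub> n = \<one>\<^bsub>group_completion\<^esub>} \<le> n"
proof (rule finite_if_finite_subsets_card_bdd)
  fix S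
  assume S: "S \<subseteq> {g \<in> carrier group_completion. g [^]\<^bsub>group_completion\<^esub> n = \<one>\<^bsub>group_completion\<^esub>}"
    and fin: "finite S"
  obtain b where b: "b \<in> carrier M" "\<And>g. g \<in> S \<Longrightarrow> \<exists>a\<in>carrier M. g = fraction a b"
  proof -
    have "S \<subseteq> carrier group_completion" using S by auto
    from common_denominator[OF fin this] show thesis using that by blast
  qed
  define B where "B = {x \<in> carrier M. x [^] n = b [^] n}"
  have "S \<subseteq> (\<lambda>a. fraction a b) ` B"
  proof
    fix g assume g: "g \<in> S"
    then obtain a where a: "a \<in> carrier M" "g = fraction a b" using b(2) by blast
    then have "fraction (a [^] n) (b [^] n) = fraction \<one> \<one>"
      using g S b(1) by (auto simp: fraction_pow group_completion_one)
    then have "a \<in> B" using a b(1) by (simp add: B_def fraction_eq_iff)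
    then show "g \<in> (\<lambda>a. fraction a b) ` B" using a by blast
  qed
  then have "card S \<le> card B" using roots[of "b [^] n"] b(1) by (intro surj_card_le) (simp_all add: B_def)
  then show "card S \<le> n" using roots[of "b [^] n"] b(1) by (simp add: B_def)
qed

end

section \<open>Quotient fields of rings of functions\<close>

text \<open>Zorn's lemma for the ideals that contain \<open>I\<close> and miss
  \<open>\<one>\<close>; the union of a nonempty chain of them still misses
  \<open>\<one>\<close>.\<close>

lemma (in cring) exists_maximalideal_containing:
  assumes I: "ideal I R" and proper: "\<one> \<notin> I"
  obtains M where "maximalideal M R" "I \<subseteq> M"
proof -
  define S where "S = {J. ideal J R \<and> I \<subseteq> J \<and> \<one> \<notin> J}"
  have "\<exists>M\<in>S. \<forall>J\<in>S. M \<subseteq> J \<longrightarrow> J = M"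
  proof (rule subset_Zorn_nonempty)
    show "S \<noteq> {}" using assms by (auto simp: S_def)
  next
    fix C assume C: "C \<noteq> {}" "subset.chain S C"
    then have "subset.chain {J. ideal J R} C" by (auto simp: subset_chain_def S_def)
    then have "ideal (\<Union>C) R" using chain_Union_is_ideal[of C] C(1) by simp
    then show "\<Union>C \<in> S" using C by (auto simp: subset_chain_def S_def)
  qed
  then obtain M where M: "ideal M R" "I \<subseteq> M" "\<one> \<notin> M" and max: "\<And>J. J \<in> S \<Longrightarrow> M \<subseteq> J \<Longrightarrow> J = M"
    by (auto simp: S_def)
  have "maximalideal M R"
  proof (rule maximalidealI[OF M(1)])
    show "carrier R \<noteq> M" using M(3) by auto
    fix J assume J: "ideal J R" "M \<subseteq> J" "J \<subseteq> carrier R"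
    show "J = M \<or> J = carrier R"
    proof (cases "\<one> \<in> J")
      case True
      then show ?thesis using ideal.one_imp_carrier[OF J(1)] by simp
    next
      case False
      then have "J \<in> S" using J M(2) by (auto simp: S_def)
      then show ?thesis using max J(2) by blast
    qed
  qed
  then show thesis using that M(2) by blast
qed

definition fun_ring :: "('i \<Rightarrow> 'k::field) ring" where
  "fun_ring = \<lparr>carrier = UNIV, monoid.mult = \<lambda>f g i. f i * g i, one = \<lambda>_. 1, ring.zero = \<lambda>_. 0, add = \<lambda>f g i. f i + g i\<rparr>"

lemma fun_ring_simps [simp]:
  "carrier fun_ring = UNIV" "f \<otimes>\<^bsub>fun_ring\<^esub> g = (\<lambda>i. f i * g i)" "\<one>\<^bsub>fun_ring\<^esub> = (\<lambda>_. 1)"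
  "\<zero>\<^bsub>fun_ring\<^esub> = (\<lambda>_. 0)" "f \<oplus>\<^bsub>fun_ring\<^esub> g = (\<lambda>i. f i + g i)"
  by (simp_all add: fun_ring_def)

lemma cring_fun_ring: "cring (fun_ring :: ('i \<Rightarrow> 'k::field) ring)"
proof (intro cringI abelian_groupI comm_monoidI)
  fix f :: "'i \<Rightarrow> 'k"
  show "\<exists>g\<in>carrier fun_ring. g \<oplus>\<^bsub>fun_ring\<^esub> f = \<zero>\<^bsub>fun_ring\<^esub>"
    by (intro bexI[of _ "\<lambda>i. - f i"]) simp_all
qed (simp_all add: algebra_simps)

lemma fun_ring_minus: "f \<ominus>\<^bsub>fun_ring\<^esub> g = (\<lambda>i. f i - g i)"
proof -
  interpret R: cring "fun_ring :: ('a \<Rightarrow> 'b) ring" by (rule cring_fun_ring)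
  have "\<ominus>\<^bsub>fun_ring\<^esub> g = (\<lambda>i. - g i)" by (rule R.minus_equality) simp_all
  then show ?thesis by (simp add: a_minus_def)
qed

lemma embeds_in_fieldI:
  assumes "pointed_monoid A"
    and closed: "\<And>a. a \<in> carrier A \<Longrightarrow> f a \<in> carrier K"
    and mult: "\<And>a b. a \<in> carrier A \<Longrightarrow> b \<in> carrier A \<Longrightarrow> f (a \<otimes>\<^bsub>A\<^esub> b) = f a \<otimes>\<^bsub>K\<^esub> f b"
    and one: "f \<one>\<^bsub>A\<^esub> = \<one>\<^bsub>K\<^esub>" and zero: "f (absorb A) = \<zero>\<^bsub>K\<^esub>"
    and inj: "inj_on f (carrier A)"
  shows "embeds_in_field A K"
proof -
  interpret A: pointed_monoid A by fact
  have "submonoid (f ` carrier A) (forget_add K)"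
  proof (rule submonoid.intro)
    show "f ` carrier A \<subseteq> carrier (forget_add K)" using closed by (auto simp: forget_add_def)
    show "\<one>\<^bsub>forget_add K\<^esub> \<in> f ` carrier A"
      using imageI[OF A.one_closed, of f] by (simp add: forget_add_def one)
    show "x \<otimes>\<^bsub>forget_add K\<^esub> y \<in> f ` carrier A"
      if "x \<in> f ` carrier A" "y \<in> f ` carrier A" for x y
      using that by (auto simp: forget_add_def simp flip: mult)
  qed
  moreover have "\<zero>\<^bsub>K\<^esub> \<in> f ` carrier A" using imageI[OF A.absorb_closed, of f] by (simp add: zero)
  ultimately have "pointed_submonoid (f ` carrier A) (forget_add K)"
    by (simp add: pointed_submonoid_def forget_add_def)
  moreover have "f \<in> iso A ((forget_add K)\<lparr>carrier := f ` carrier A\<rparr>)"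
    using inj mult by (auto simp: iso_def hom_def forget_add_def bij_betw_def)
  ultimately show ?thesis
    unfolding embeds_in_field_def pm_isomorphic_def
    by (intro exI[of _ "f ` carrier A"] conjI exI[of _ f]) (simp_all add: one zero forget_add_def)
qed

text \<open>In effect an ultrapower, with a maximal ideal in place of an ultrafilter. The functions
  that eventually vanish form an ideal \<open>J\<close>, proper because the filter is not
  \<open>bot\<close>, and a maximal ideal above \<open>J\<close> is factored out.\<close>

lemma field_quotient_of_fun_ring:
  fixes \<F> :: "'i filter"
  assumes "\<F> \<noteq> bot"
  obtains K :: "('i \<Rightarrow> 'k::field) set ring" and \<pi> :: "('i \<Rightarrow> 'k) \<Rightarrow> ('i \<Rightarrow> 'k) set"
  where "field K" "\<pi> \<in> ring_hom fun_ring K"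
    and "\<And>u v. eventually (\<lambda>i. u i = v i) \<F> \<Longrightarrow> \<pi> u = \<pi> v"
    and "\<And>u v. eventually (\<lambda>i. u i \<noteq> v i) \<F> \<Longrightarrow> \<pi> u \<noteq> \<pi> v"
proof -
  define R where "R = (fun_ring :: ('i \<Rightarrow> 'k) ring)"
  interpret R: cring R unfolding R_def by (rule cring_fun_ring)
  define J where "J = {u :: 'i \<Rightarrow> 'k. eventually (\<lambda>i. u i = 0) \<F>}"
  have J: "ideal J R"
  proof (rule idealI[OF R.ring_axioms])
    show "subgroup J (add_monoid R)"
    proof (rule R.add.subgroupI)
      show "J \<subseteq> carrier R" by (simp add: R_def)
      have "(\<lambda>_. 0) \<in> J" by (simp add: J_def)
      then show "J \<noteq> {}" by blast
    next
      fix u assume "u \<in> J"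
      then have "(\<lambda>i. - u i) \<in> J" by (simp add: J_def)
      moreover have "\<ominus>\<^bsub>R\<^esub> u = (\<lambda>i. - u i)" by (rule R.minus_equality) (simp_all add: R_def)
      ultimately show "\<ominus>\<^bsub>R\<^esub> u \<in> J" by simp
    next
      fix u v assume "u \<in> J" "v \<in> J"
      then have "eventually (\<lambda>i. u i + v i = 0) \<F>"
        unfolding J_def mem_Collect_eq by eventually_elim simp
      then show "u \<oplus>\<^bsub>R\<^esub> v \<in> J" by (simp add: J_def R_def)
    qed
  next
    fix u w assume "u \<in> J"
    then have "eventually (\<lambda>i. w i * u i = 0) \<F>"
      unfolding J_def mem_Collect_eq by eventually_elim simp
    then show "w \<otimes>\<^bsub>R\<^esub> u \<in> J" "u \<otimes>\<^bsub>R\<^esub> w \<in> J" by (simp_all add: J_def R_def mult.commute)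
  qed
  have "\<one>\<^bsub>R\<^esub> \<notin> J" using assms by (simp add: J_def R_def)
  then obtain M where M: "maximalideal M R" and JM: "J \<subseteq> M"
    using R.exists_maximalideal_containing[OF J] by blast
  interpret M: maximalideal M R by (rule M)
  define \<pi> where "\<pi> u = M +>\<^bsub>R\<^esub> u" for u
  have \<pi>_eq_iff: "\<pi> u = \<pi> v \<longleftrightarrow> (\<lambda>i. u i - v i) \<in> M" for u v
    using R.quotient_eq_iff_same_a_r_cos[OF M.is_ideal, of u v]
    by (simp add: \<pi>_def R_def fun_ring_minus)
  show thesis
  proof (rule that)
    show "field (R Quot M)" by (rule M.quotient_is_field[OF R.is_cring])
    show "\<pi> \<in> ring_hom fun_ring (R Quot M)"
      using M.rcos_ring_hom unfolding \<pi>_def R_def .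
  next
    fix u v :: "'i \<Rightarrow> 'k"
    assume "eventually (\<lambda>i. u i = v i) \<F>"
    then have "(\<lambda>i. u i - v i) \<in> J" by (simp add: J_def)
    then show "\<pi> u = \<pi> v" using JM by (auto simp: \<pi>_eq_iff)
  next
    fix u v :: "'i \<Rightarrow> 'k"
    assume neq: "eventually (\<lambda>i. u i \<noteq> v i) \<F>"
    \<comment> \<open>modulo the ideal \<open>J\<close>, \<open>u - v\<close> is a unit\<close>
    define w where "w i = (u i - v i) * inverse (u i - v i)" for i
    \<comment> \<open>Since \<open>inverse 0 = 0\<close>, \<open>w\<close> is the indicator function
      of the set where \<open>u\<close> and \<open>v\<close> differ. If \<open>u - v\<close> were in
      \<open>M\<close>, its multiple \<open>w\<close> would be too, and adding \<open>1 - w\<close>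
      would give the unit.\<close>
    have "eventually (\<lambda>i. 1 - w i = 0) \<F>"
      using neq by eventually_elim (simp add: w_def)
    then have "(\<lambda>i. 1 - w i) \<in> M" using JM by (auto simp: J_def)
    show "\<pi> u \<noteq> \<pi> v"
    proof
      assume "\<pi> u = \<pi> v"
      then have "w \<in> M"
        using M.I_r_closed[of "\<lambda>i. u i - v i" "\<lambda>i. inverse (u i - v i)"]
        by (simp add: \<pi>_eq_iff R_def w_def[abs_def])
      with \<open>(\<lambda>i. 1 - w i) \<in> M\<close> have "\<one>\<^bsub>R\<^esub> \<in> M"
        using M.a_closed[of "\<lambda>i. 1 - w i" w] by (simp add: R_def)
      then show False using M.I_notcarr M.one_imp_carrier by simp
    qed
  qed
qed

text \<open>A compactness argument: \<open>a\<close> is sent to the class of the family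
  \<open>\<lambda>F. \<chi> F a\<close>, and the laws that hold for all large \<open>F\<close> hold
  in the quotient field.\<close>

lemma pm_domain_if_finite_embeddings:
  fixes A :: "('a, 'b) pointed_monoid_scheme"
  assumes A: "pointed_monoid A"
    and fin: "\<And>F. finite F \<Longrightarrow> F \<subseteq> carrier A \<Longrightarrow>
      \<exists>\<chi> :: 'a \<Rightarrow> 'k::field. \<chi> \<one>\<^bsub>A\<^esub> = 1 \<and> \<chi> (absorb A) = 0 \<and>
        (\<forall>a\<in>F. \<forall>b\<in>F. \<chi> (a \<otimes>\<^bsub>A\<^esub> b) = \<chi> a * \<chi> b) \<and> inj_on \<chi> F"
  shows "pm_domain A"
proof -
  obtain \<chi> :: "'a set \<Rightarrow> 'a \<Rightarrow> 'k" where
    \<chi>: "\<And>F. finite F \<Longrightarrow> F \<subseteq> carrier A \<Longrightarrow> \<chi> F \<one>\<^bsub>A\<^esub> = 1 \<and> \<chi> F (absorb A) = 0 \<and>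
        (\<forall>a\<in>F. \<forall>b\<in>F. \<chi> F (a \<otimes>\<^bsub>A\<^esub> b) = \<chi> F a * \<chi> F b) \<and> inj_on (\<chi> F) F"
    using fin by metis
  define \<F> where "\<F> = finite_subsets_at_top (carrier A)"
  \<comment> \<open>Each law to be checked involves at most two given elements, and these belong to
    every sufficiently large \<open>F\<close>. The product \<open>a \<otimes> b\<close> itself need
    not belong to \<open>F\<close>.\<close>
  have ev: "eventually P \<F>"
    if "\<And>F. finite F \<Longrightarrow> F \<subseteq> carrier A \<Longrightarrow> a \<in> F \<Longrightarrow> b \<in> F \<Longrightarrow> P F" "a \<in> carrier A" "b \<in> carrier A"
    for P a b
    unfolding \<F>_def eventually_finite_subsets_at_top
    by (rule exI[of _ "{a, b}"]) (use that in auto)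
  have "\<F> \<noteq> bot" by (simp add: \<F>_def)
  then obtain K :: "('a set \<Rightarrow> 'k) set ring"
    and \<pi> :: "('a set \<Rightarrow> 'k) \<Rightarrow> ('a set \<Rightarrow> 'k) set" where K: "field K"
    and \<pi>: "\<pi> \<in> ring_hom fun_ring K"
    and \<pi>_eq: "\<And>u v. eventually (\<lambda>F. u F = v F) \<F> \<Longrightarrow> \<pi> u = \<pi> v"
    and \<pi>_neq: "\<And>u v. eventually (\<lambda>F. u F \<noteq> v F) \<F> \<Longrightarrow> \<pi> u \<noteq> \<pi> v"
    using field_quotient_of_fun_ring[of \<F>] by blast
  interpret A: pointed_monoid A by (rule A)
  define f where "f a = \<pi> (\<lambda>F. \<chi> F a)" for a
  have "embeds_in_field A K"
  proof (rule embeds_in_fieldI[OF A])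
    show "f a \<in> carrier K" for a
      unfolding f_def by (rule ring_hom_closed[OF \<pi>]) simp
    show "f (a \<otimes>\<^bsub>A\<^esub> b) = f a \<otimes>\<^bsub>K\<^esub> f b" if ab: "a \<in> carrier A" "b \<in> carrier A" for a b
    proof -
      have "f (a \<otimes>\<^bsub>A\<^esub> b) = \<pi> (\<lambda>F. \<chi> F a * \<chi> F b)"
        unfolding f_def using \<chi> by (intro \<pi>_eq ev[of a b]) (simp_all add: ab)
      then show ?thesis
        unfolding f_def using ring_hom_mult[OF \<pi>, of "\<lambda>F. \<chi> F a" "\<lambda>F. \<chi> F b"] by simp
    qed
    have "f \<one>\<^bsub>A\<^esub> = \<pi> (\<lambda>_. 1)"
      unfolding f_def using \<chi> by (intro \<pi>_eq ev[of "\<one>\<^bsub>A\<^esub>" "\<one>\<^bsub>A\<^esub>"]) simp_all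
    then show "f \<one>\<^bsub>A\<^esub> = \<one>\<^bsub>K\<^esub>" using ring_hom_one[OF \<pi>] by simp
    have "f (absorb A) = \<pi> (\<lambda>_. 0)"
      unfolding f_def using \<chi> by (intro \<pi>_eq ev[of "absorb A" "absorb A"]) (simp_all add: A.absorb_closed)
    then show "f (absorb A) = \<zero>\<^bsub>K\<^esub>"
      using ring_hom_zero[OF \<pi> cring.axioms(1)[OF cring_fun_ring]] cring.axioms(1)[OF fieldE(1)[OF K]] by simp
    show "inj_on f (carrier A)"
    proof (rule inj_onI, rule ccontr)
      fix a b assume ab: "a \<in> carrier A" "b \<in> carrier A" "a \<noteq> b" and eq: "f a = f b"
      have "eventually (\<lambda>F. \<chi> F a \<noteq> \<chi> F b) \<F>"
        using \<chi> ab by (intro ev[of a b]) (auto dest: inj_onD)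
      from \<pi>_neq[OF this] show False using eq by (simp add: f_def)
    qed
  qed
  \<comment> \<open>The elements of \<open>K\<close> are sets of functions;
    \<open>pm_domainI\<close> transfers the embedding to a field of the type fixed in
    \<open>pm_domain\<close>.\<close>
  then show ?thesis by (rule pm_domainI[OF A K])
qed

section \<open>Roots and domains\<close>

lemma (in field) card_power_roots_le:
  assumes \<alpha>: "\<alpha> \<in> carrier R" and n: "(n::nat) \<ge> 1"
  shows "finite {x \<in> carrier R. x [^] n = \<alpha>} \<and> card {x \<in> carrier R. x [^] n = \<alpha>} \<le> n"
proof -
  obtain m where m: "n = Suc m" using n by (cases n) auto
  \<comment> \<open>The polynomial X^n - \<alpha>, leading coefficient first; between its two
    nonzero-degree ends stand \<open>m = n - 1\<close> zeros.\<close>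
  define p where "p = \<one> # replicate m \<zero> @ [\<ominus> \<alpha>]"
  have p: "p \<in> carrier (poly_ring R)"
    using \<alpha> unfolding univ_poly_carrier[symmetric] by (simp add: p_def polynomial_def set_replicate_conv_if)
  have tail: "eval (replicate k \<zero> @ [\<ominus> \<alpha>]) x = \<ominus> \<alpha>" if "x \<in> carrier R" for k x
    using that \<alpha> by (induction k) simp_all
  have "x \<in># roots p" if x: "x \<in> carrier R" "x [^] n = \<alpha>" for x
  proof -
    have "eval p x = \<zero>"
      using x \<alpha> by (simp add: p_def tail m r_neg)
    then have "is_root p x" using x by (simp add: is_root_def p_def)
    then show ?thesis using roots_mem_iff_is_root[OF p] by simp
  qed
  then have sub: "{x \<in> carrier R. x [^] n = \<alpha>} \<subseteq> set_mset (roots p)" by auto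
  have "card {x \<in> carrier R. x [^] n = \<alpha>} \<le> card (set_mset (roots p))"
    using sub by (rule card_mono[rotated]) simp
  also have "\<dots> \<le> size (roots p)"
    by (metis mset_set_set_mset_msubset size_mset_mono size_mset_set)
  also have "\<dots> \<le> n" using size_roots_le_degree[OF p] by (simp add: p_def m)
  finally show ?thesis using sub finite_subset by blast
qed

text \<open>Both properties hold in a field and are pulled back along an injective homomorphism that
  sends the absorbing element to zero.\<close>

lemma pm_domain_imp:
  assumes A: "pointed_monoid A" and dom: "pm_domain A"
  shows "pm_integral A"
    and "\<alpha> \<in> carrier A \<Longrightarrow> (n::nat) \<ge> 1 \<Longrightarrow>
      finite {x \<in> carrier A. x [^]\<^bsub>A\<^esub> n = \<alpha>} \<and> card {x \<in> carrier A. x [^]\<^bsub>A\<^esub> n = \<alpha>} \<le> n"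
proof -
  interpret A: pointed_monoid A by (rule A)
  obtain K :: "('a + nat) list ring" and S f where K: "field K"
    and S: "pointed_submonoid S (forget_add K)"
    and f: "f \<in> iso A ((forget_add K)\<lparr>carrier := S\<rparr>)"
    and f1: "f \<one>\<^bsub>A\<^esub> = \<one>\<^bsub>K\<^esub>" and f0: "f (absorb A) = \<zero>\<^bsub>K\<^esub>"
    using dom by (auto simp: pm_domain_def embeds_in_field_def pm_isomorphic_def forget_add_def)
  interpret K: field K by (rule K)
  have "S \<subseteq> carrier K"
    using S submonoid.subset by (fastforce simp: pointed_submonoid_def forget_add_def)
  then have fK: "f a \<in> carrier K" if "a \<in> carrier A" for a
    using f that by (auto simp: iso_def hom_def)
  have inj: "inj_on f (carrier A)" using f by (auto simp: iso_def bij_betw_def)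
  have mult: "f (a \<otimes>\<^bsub>A\<^esub> b) = f a \<otimes>\<^bsub>K\<^esub> f b" if "a \<in> carrier A" "b \<in> carrier A" for a b
    using f that by (auto simp: iso_def hom_def forget_add_def)
  have pow: "f (a [^]\<^bsub>A\<^esub> k) = f a [^]\<^bsub>K\<^esub> k" if "a \<in> carrier A" for a and k :: nat
    using that by (induction k) (simp_all add: f1 mult)
  show "pm_integral A"
    unfolding pm_integral_def
  proof (intro ballI impI)
    fix a b c assume abc: "a \<in> carrier A" "b \<in> carrier A" "c \<in> carrier A"
      and eq: "a \<otimes>\<^bsub>A\<^esub> b = a \<otimes>\<^bsub>A\<^esub> c"
    have "f a \<otimes>\<^bsub>K\<^esub> f b = f a \<otimes>\<^bsub>K\<^esub> f c" using eq mult abc by metis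
    then have "f a = \<zero>\<^bsub>K\<^esub> \<or> f b = f c" using K.m_lcancel fK abc by blast
    then show "a = absorb A \<or> b = c"
      using inj_onD[OF inj] f0 abc A.absorb_closed by metis
  qed
  assume \<alpha>: "\<alpha> \<in> carrier A" and n: "n \<ge> 1"
  define B where "B = {y \<in> carrier K. y [^]\<^bsub>K\<^esub> n = f \<alpha>}"
  have B: "finite B" "card B \<le> n"
    using K.card_power_roots_le[OF fK[OF \<alpha>] n] by (simp_all add: B_def)
  have sub: "f ` {x \<in> carrier A. x [^]\<^bsub>A\<^esub> n = \<alpha>} \<subseteq> B"
    using fK by (auto simp: B_def simp flip: pow)
  have inj': "inj_on f {x \<in> carrier A. x [^]\<^bsub>A\<^esub> n = \<alpha>}" using inj by (rule inj_on_subset) auto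
  show "finite {x \<in> carrier A. x [^]\<^bsub>A\<^esub> n = \<alpha>} \<and> card {x \<in> carrier A. x [^]\<^bsub>A\<^esub> n = \<alpha>} \<le> n"
    using inj_on_finite[OF inj' sub B(1)] card_inj_on_le[OF inj' sub B(1)] B(2) by simp
qed

lemma pm_domain_if_power_roots_bounded:
  assumes A: "pointed_monoid A" and nontriv: "\<one>\<^bsub>A\<^esub> \<noteq> absorb A" and int: "pm_integral A"
    and roots: "\<And>\<alpha> n::nat. \<alpha> \<in> carrier A \<Longrightarrow> n \<ge> 1 \<Longrightarrow>
      finite {x \<in> carrier A. x [^]\<^bsub>A\<^esub> n = \<alpha>} \<and> card {x \<in> carrier A. x [^]\<^bsub>A\<^esub> n = \<alpha>} \<le> n"
  shows "pm_domain A"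
proof -
  interpret A: pointed_monoid A by (rule A)
  \<comment> \<open>Removing the absorbing element turns integrality into cancellation; the unit
    survives by \<open>nontriv\<close>.\<close>
  define M where "M = A\<lparr>carrier := carrier A - {absorb A}\<rparr>"
  have cancel: "b = c" if "a \<in> carrier A" "b \<in> carrier A" "c \<in> carrier A" "a \<noteq> absorb A"
    "a \<otimes>\<^bsub>A\<^esub> b = a \<otimes>\<^bsub>A\<^esub> c" for a b c
    using int that by (auto simp: pm_integral_def)
  have absorb_r: "a \<otimes>\<^bsub>A\<^esub> absorb A = absorb A" if "a \<in> carrier A" for a
    using A.absorb_mult[OF that] A.m_comm[OF that A.absorb_closed] by simp
  \<comment> \<open>Integrality excludes zero divisors: a product equal to \<open>absorb A\<close>
    equals \<open>a\<close> times \<open>absorb A\<close>, and \<open>a\<close> cancels.\<close>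
  have nz: "a \<otimes>\<^bsub>A\<^esub> b \<noteq> absorb A" if "a \<in> carrier M" "b \<in> carrier M" for a b
    using cancel[of a b "absorb A"] that absorb_r[of a] A.absorb_closed by (auto simp: M_def)
  interpret M: cancel_comm_monoid M
  proof (intro cancel_comm_monoid.intro comm_monoidI cancel_comm_monoid_axioms.intro)
    show "x \<otimes>\<^bsub>M\<^esub> y \<in> carrier M" if "x \<in> carrier M" "y \<in> carrier M" for x y
      using nz[OF that] that by (simp add: M_def)
    show "b = c" if "a \<in> carrier M" "b \<in> carrier M" "c \<in> carrier M" "a \<otimes>\<^bsub>M\<^esub> b = a \<otimes>\<^bsub>M\<^esub> c" for a b c
      using cancel[of a b c] that by (simp add: M_def)
  qed (use nontriv in \<open>auto simp: M_def A.m_ac\<close>)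
  define G where "G = M.group_completion"
  interpret G: comm_group G unfolding G_def by (rule M.comm_group_group_completion)
  have Groots: "finite {g \<in> carrier G. g [^]\<^bsub>G\<^esub> n = \<one>\<^bsub>G\<^esub>} \<and> card {g \<in> carrier G. g [^]\<^bsub>G\<^esub> n = \<one>\<^bsub>G\<^esub>} \<le> n"
    if n: "n \<ge> 1" for n :: nat
    unfolding G_def
  proof (rule M.group_completion_roots[OF n])
    fix \<alpha> assume \<alpha>: "\<alpha> \<in> carrier M"
    have "x [^]\<^bsub>M\<^esub> n = x [^]\<^bsub>A\<^esub> n" for x
      unfolding M_def by (rule A.nat_pow_consistent[symmetric])
    then have sub: "{x \<in> carrier M. x [^]\<^bsub>M\<^esub> n = \<alpha>} \<subseteq> {x \<in> carrier A. x [^]\<^bsub>A\<^esub> n = \<alpha>}"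
      by (auto simp: M_def)
    have "\<alpha> \<in> carrier A" using \<alpha> by (simp add: M_def)
    from roots[OF this n] show "finite {x \<in> carrier M. x [^]\<^bsub>M\<^esub> n = \<alpha>} \<and> card {x \<in> carrier M. x [^]\<^bsub>M\<^esub> n = \<alpha>} \<le> n"
      using sub by (meson card_mono finite_subset le_trans)
  qed
  show ?thesis
  proof (rule pm_domain_if_finite_embeddings[OF A])
    fix F assume F: "finite F" "F \<subseteq> carrier A"
    define F' where "F' = F - {absorb A}"
    have F': "finite F'" "F' \<subseteq> carrier M" using F by (auto simp: F'_def M_def)
    have "M.of_monoid ` F' \<subseteq> carrier G"
      using F'(2) M.of_monoid_closed by (auto simp: G_def)
    then obtain H \<psi> where H: "subgroup H G" "M.of_monoid ` F' \<subseteq> H"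
      and \<psi>: "G.complex_character H \<psi>" and inj\<psi>: "inj_on \<psi> (M.of_monoid ` F')"
      using G.complex_character_separating_finite[OF finite_imageI[OF F'(1)] _ Groots] by blast
    \<comment> \<open>The character is extended by zero. As its values on \<open>H\<close> are
      nonzero, the absorbing element stays separated from the rest of \<open>F\<close>.\<close>
    define \<chi> where "\<chi> a = (if a = absorb A then 0 else \<psi> (M.of_monoid a))" for a
    have 1: "\<chi> \<one>\<^bsub>A\<^esub> = 1"
    proof -
      have "M.of_monoid \<one>\<^bsub>A\<^esub> = \<one>\<^bsub>G\<^esub>" using M.of_monoid_one by (simp add: M_def G_def)
      then show ?thesis using nontriv G.complex_character_one[OF \<psi> H(1)] by (simp add: \<chi>_def)
    qed
    \<comment> \<open>The product may leave \<open>F\<close>, but \<open>\<psi>\<close> is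
      multiplicative on all of \<open>H\<close>, which contains the images of both factors.\<close>
    have 2: "\<chi> (a \<otimes>\<^bsub>A\<^esub> b) = \<chi> a * \<chi> b" if "a \<in> F" "b \<in> F" for a b
    proof (cases "a = absorb A \<or> b = absorb A")
      case True
      then show ?thesis using that F(2) A.absorb_mult absorb_r by (auto simp: \<chi>_def)
    next
      case False
      then have ab: "a \<in> F'" "b \<in> F'" using that by (auto simp: F'_def)
      then have "a \<in> carrier M" "b \<in> carrier M" using F'(2) by auto
      then have "M.of_monoid (a \<otimes>\<^bsub>A\<^esub> b) = M.of_monoid a \<otimes>\<^bsub>G\<^esub> M.of_monoid b" "a \<otimes>\<^bsub>A\<^esub> b \<noteq> absorb A"
        using M.of_monoid_mult[of a b] nz[of a b] by (simp_all add: M_def G_def)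
      moreover have "M.of_monoid a \<in> H" "M.of_monoid b \<in> H" using H(2) ab by auto
      ultimately show ?thesis using False G.complex_characterD(2)[OF \<psi>] by (simp add: \<chi>_def)
    qed
    have "inj_on \<chi> F'"
    proof -
      have "inj_on (\<psi> \<circ> M.of_monoid) F'"
        using inj\<psi> inj_on_subset[OF M.inj_on_of_monoid F'(2)] by (rule comp_inj_on[rotated])
      then show ?thesis by (rule inj_on_cong[THEN iffD1, rotated]) (simp add: \<chi>_def F'_def)
    qed
    moreover have "\<chi> a \<noteq> 0" if "a \<in> F'" for a
      using that G.complex_characterD(1)[OF \<psi>, of "M.of_monoid a"] H(2) by (auto simp: \<chi>_def F'_def)
    ultimately have "inj_on \<chi> F"
      by (auto simp: inj_on_def F'_def \<chi>_def)
    then show "\<exists>\<chi> :: 'a \<Rightarrow> complex. \<chi> \<one>\<^bsub>A\<^esub> = 1 \<and> \<chi> (absorb A) = 0 \<and>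
        (\<forall>a\<in>F. \<forall>b\<in>F. \<chi> (a \<otimes>\<^bsub>A\<^esub> b) = \<chi> a * \<chi> b) \<and> inj_on \<chi> F"
      using 1 2 by (intro exI[of _ \<chi>]) (simp add: \<chi>_def)
  qed
qed

text \<open>The assumption \<open>\<one> \<noteq> absorb A\<close> excludes only the one-element
  monoid, treated in \<open>one_eq_absorb_not_domain\<close>. Finiteness is demanded separately
  because \<open>card\<close> is 0 on infinite sets.\<close>

theorem corollary4p6:
  fixes A :: "('a, 'b) pointed_monoid_scheme"
  assumes "pointed_monoid A"
    and "\<one>\<^bsub>A\<^esub> \<noteq> absorb A"
  shows "pm_domain A \<longleftrightarrow>
    pm_integral A \<and>
    (\<forall>\<alpha>\<in>carrier A. \<forall>n::nat. n \<ge> 1 \<longrightarrow>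
       finite {x \<in> carrier A. x [^]\<^bsub>A\<^esub> n = \<alpha>} \<and>
       card {x \<in> carrier A. x [^]\<^bsub>A\<^esub> n = \<alpha>} \<le> n)"
  using pm_domain_imp[OF assms(1)] pm_domain_if_power_roots_bounded[OF assms] by blast

end
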